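(* Let $\alpha\in[0,1]$ and consider the hyperbolic relaxation system $$\partial_t u+\partial_x v=0,\qquad \partial_t v+\frac{1}{\varepsilon^{2\alpha}}\partial_x p(u)=-\frac{1}{\varepsilon^{1+\alpha}}\bigl(v-f(u)\bigr),$$ with $p'(u)>0$. Let an $s$-stage IMEX-RK method $(\tilde A,\tilde b;A,b)$ of type I or type II be applied to it in time, with time step $\Delta t>0$, in the form $$U=u^n e-\Delta t\,A\,V_x,\qquad V=v^n e-\frac{\Delta t}{\varepsilon^{1+\alpha}}\tilde A\bigl(\varepsilon^{1-\alpha}p(U)_x-f(U)\bigr)-\frac{\Delta t}{\varepsilon^{1+\alpha}}A V,$$ $$u^{n+1}=u^n-\Delta t\,b^T V_x,\qquad v^{n+1}=v^n-\frac{\Delta t}{\varepsilon^{1+\alpha}}\tilde b^T\bigl(\varepsilon^{1-\alpha}p(U)_x-f(U)\bigr)-\frac{\Delta t}{\varepsilon^{1+\alpha}}b^T V.$$ If the IMEX-RK method is globally stiffly accurate (GSA), then as $\varepsilon\to0$ the scheme becomes the explicit Runge-Kutta scheme characterized by the pair $(\tilde A,\tilde b)$ applied to the limit equation for $u$, namely: (i) for $\alpha=1$, the explicit Runge-Kutta scheme for the convection-diffusion equation $\partial_t u+\partial_x f(u)=\partial_{xx}p(u)$, that is $$\frac{U-u^n e}{\Delta t}+\tilde A f(U)_x=\tilde A p(U)_{xx},\qquad \frac{u^{n+1}-u^n}{\Delta t}+\tilde b^T f(U)_x=\tilde b^T p(U)_{xx};$$ (ii) for $\alpha\in[0,1)$,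 the explicit Runge-Kutta scheme for the scalar conservation law $\partial_t u+\partial_x f(u)=0$, that is $$\frac{U-u^n e}{\Delta t}+\tilde A f(U)_x=0,\qquad \frac{u^{n+1}-u^n}{\Delta t}+\tilde b^T f(U)_x=0.$$
   Context: The schemes are discrete in time and continuous in the space variable $x$; subscripts $x$, $xx$ denote space derivatives. $u^n,v^n$ are the (scalar, smooth in $x$) approximations of $u,v$ at time level $n$. $U=(U^1,\dots,U^s)^T$ and $V=(V^1,\dots,V^s)^T$ are the vectors of internal stages (each component a function of $x$), $f(U)$ and $p(U)$ are the vectors with components $f(U^i)$ and $p(U^i)$, and $e=(1,\dots,1)^T\in\mathbb R^s$. An $s$-stage IMEX-RK method is given by two Butcher tableaux: an explicit one $(\tilde A,\tilde b)$, with $\tilde A=(\tilde a_{ij})\in\mathbb R^{s\times s}$ strictly lower triangular and $\tilde b=(\tilde b_i)\in\mathbb R^s$, and a diagonally implicit one $(A,b)$, with $A=(a_{ij})\in\mathbb R^{s\times s}$ lower triangular and $b=(b_i)\in\mathbb R^s$. It is of type I if $A$ is invertible (all $a_{ii}\ne0$); it is of type II if $A=\begin{pmatrix}0&0\\ a&\hat A\end{pmatrix}$ with $a\in\mathbb R^{s-1}$ and $\hat A\in\mathbb R^{(s-1)\times(s-1)}$ invertible ($a_{ii}\neq 0$ for $i=2,\dots,s$). The method is globally stiffly accurate (GSA) if $a_{si}=b_i$ for $i=1,\dots,s$ and $\tilde a_{si}=\tilde b_i$ for $i=1,\dots,s-1$, with $\tilde b_s=0$; equivalently $b^T=e_s^TA$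 and $\tilde b^T=e_s^T\tilde A$, where $e_s=(0,\dots,0,1)^T$. The limit $\varepsilon\to0$ is formal (leading order in $\varepsilon$), taken with $\Delta t>0$, the functions $f,p$ and the data $u^n,v^n$ fixed independently of $\varepsilon$; the assertion concerns the relations determining $U$ and $u^{n+1}$. *)

theory Defs
  imports "HOL-Analysis.Analysis"
begin

section \<open>Smooth functions of the space variable\<close>

definition dx :: "(real \<Rightarrow> 'a::real_normed_vector) \<Rightarrow> real \<Rightarrow> 'a" where
  "dx g = (\<lambda>x. vector_derivative g (at x))"

definition smooth :: "(real \<Rightarrow> 'a::real_normed_vector) \<Rightarrow> bool" where
  "smooth g \<longleftrightarrow> (\<forall>k x. (dx ^^ k) g differentiable (at x))"

text \<open>The leading order term of a family indexed by \<open>\<epsilon> > 0\<close>: the limit as \<open>\<epsilon>\<close> tends to \<open>0\<close>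
  from the right, which has to be compatible with all \<open>x\<close>-derivatives.\<close>

definition leading_order ::
    "(real \<Rightarrow> real \<Rightarrow> 'a::real_normed_vector) \<Rightarrow> (real \<Rightarrow> 'a) \<Rightarrow> bool" where
  "leading_order G g \<longleftrightarrow>
     smooth g \<and> (\<forall>k x. ((\<lambda>\<epsilon>. (dx ^^ k) (G \<epsilon>) x) \<longlongrightarrow> (dx ^^ k) g x) (at_right 0))"

section \<open>IMEX Runge--Kutta tableaux\<close>

text \<open>The stages are indexed by a finite well-ordered type \<open>'s\<close>, with \<open>s = CARD('s)\<close>.\<close>

definition first_stage :: "'s::{finite,wellorder}" where
  "first_stage = Min UNIV"

definition last_stage :: "'s::{finite,wellorder}" where
  "last_stage = Max UNIV"

definition imex_tableaux :: "real^'s::{finite,wellorder}^'s::_ \<Rightarrow> real^'s::_^'s::_ \<Rightarrow> bool" where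
  "imex_tableaux At A \<longleftrightarrow>
     (\<forall>i j. i \<le> j \<longrightarrow> At $ i $ j = 0) \<and> (\<forall>i j. i < j \<longrightarrow> A $ i $ j = 0)"

definition type_I :: "real^'s::{finite,wellorder}^'s::_ \<Rightarrow> bool" where
  "type_I A \<longleftrightarrow> invertible A"

text \<open>Invertibility of the square submatrix of \<open>A\<close> with rows and columns in \<open>S\<close>; only the
  entries of \<open>B\<close> with indices in \<open>S\<close> matter.\<close>

definition submatrix_invertible :: "'s set \<Rightarrow> real^'s::finite^'s::finite \<Rightarrow> bool" where
  "submatrix_invertible S A \<longleftrightarrow> (\<exists>B::real^'s::finite^'s::finite. \<forall>i\<in>S. \<forall>j\<in>S.
     (\<Sum>k\<in>S. A $ i $ k * B $ k $ j) = (if i = j then 1 else 0) \<and>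
     (\<Sum>k\<in>S. B $ i $ k * A $ k $ j) = (if i = j then 1 else 0))"

definition type_II :: "real^'s::{finite,wellorder}^'s::_ \<Rightarrow> bool" where
  "type_II A \<longleftrightarrow> row first_stage A = 0 \<and> submatrix_invertible (- {first_stage}) A"

definition globally_stiffly_accurate ::
    "real^'s::{finite,wellorder}^'s::_ \<Rightarrow> real^'s::_ \<Rightarrow> real^'s::_^'s::_ \<Rightarrow> real^'s::_ \<Rightarrow> bool" where
  "globally_stiffly_accurate At bt A b \<longleftrightarrow>
     (\<forall>i. A $ last_stage $ i = b $ i) \<and>
     (\<forall>i. i \<noteq> last_stage \<longrightarrow> At $ last_stage $ i = bt $ i) \<and> bt $ last_stage = 0"

section \<open>The schemes\<close>

definition stagewise :: "(real \<Rightarrow> real) \<Rightarrow> (real \<Rightarrow> real^'s) \<Rightarrow> real \<Rightarrow> real^'s" where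
  "stagewise f U = (\<lambda>x. \<chi> i. f (U x $ i))"

definition imex_step ::
    "real^'s^'s \<Rightarrow> real^'s \<Rightarrow> real^'s^'s \<Rightarrow> real^'s \<Rightarrow> (real \<Rightarrow> real) \<Rightarrow> (real \<Rightarrow> real) \<Rightarrow>
     real \<Rightarrow> real \<Rightarrow> real \<Rightarrow> (real \<Rightarrow> real) \<Rightarrow> (real \<Rightarrow> real) \<Rightarrow>
     (real \<Rightarrow> real^'s) \<Rightarrow> (real \<Rightarrow> real^'s) \<Rightarrow> (real \<Rightarrow> real) \<Rightarrow> (real \<Rightarrow> real) \<Rightarrow> bool" where
  "imex_step At bt A b f p \<alpha> \<Delta>t \<epsilon> un vn U V u1 v1 \<longleftrightarrow>
     smooth U \<and> smooth V \<and> smooth u1 \<and> smooth v1 \<and>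
     (\<forall>x. U x = un x *\<^sub>R vec 1 - \<Delta>t *\<^sub>R (A *v dx V x)) \<and>
     (\<forall>x. V x = vn x *\<^sub>R vec 1
        - (\<Delta>t / \<epsilon> powr (1 + \<alpha>)) *\<^sub>R
            (At *v (\<epsilon> powr (1 - \<alpha>) *\<^sub>R dx (stagewise p U) x - stagewise f U x))
        - (\<Delta>t / \<epsilon> powr (1 + \<alpha>)) *\<^sub>R (A *v V x)) \<and>
     (\<forall>x. u1 x = un x - \<Delta>t * (b \<bullet> dx V x)) \<and>
     (\<forall>x. v1 x = vn x
        - \<Delta>t / \<epsilon> powr (1 + \<alpha>) *
            (bt \<bullet> (\<epsilon> powr (1 - \<alpha>) *\<^sub>R dx (stagewise p U) x - stagewise f U x))
        - \<Delta>t / \<epsilon> powr (1 + \<alpha>) * (b \<bullet> V x))"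

definition rk_step_convection_diffusion ::
    "real^'s^'s \<Rightarrow> real^'s \<Rightarrow> (real \<Rightarrow> real) \<Rightarrow> (real \<Rightarrow> real) \<Rightarrow> real \<Rightarrow> (real \<Rightarrow> real) \<Rightarrow>
     (real \<Rightarrow> real^'s) \<Rightarrow> (real \<Rightarrow> real) \<Rightarrow> bool" where
  "rk_step_convection_diffusion At bt f p \<Delta>t un U u1 \<longleftrightarrow>
     smooth U \<and> smooth u1 \<and>
     (\<forall>x. (U x - un x *\<^sub>R vec 1) /\<^sub>R \<Delta>t + At *v dx (stagewise f U) x
            = At *v dx (dx (stagewise p U)) x) \<and>
     (\<forall>x. (u1 x - un x) / \<Delta>t + bt \<bullet> dx (stagewise f U) x
            = bt \<bullet> dx (dx (stagewise p U)) x)"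

definition rk_step_conservation_law ::
    "real^'s^'s \<Rightarrow> real^'s \<Rightarrow> (real \<Rightarrow> real) \<Rightarrow> real \<Rightarrow> (real \<Rightarrow> real) \<Rightarrow>
     (real \<Rightarrow> real^'s) \<Rightarrow> (real \<Rightarrow> real) \<Rightarrow> bool" where
  "rk_step_conservation_law At bt f \<Delta>t un U u1 \<longleftrightarrow>
     smooth U \<and> smooth u1 \<and>
     (\<forall>x. (U x - un x *\<^sub>R vec 1) /\<^sub>R \<Delta>t + At *v dx (stagewise f U) x = 0) \<and>
     (\<forall>x. (u1 x - un x) / \<Delta>t + bt \<bullet> dx (stagewise f U) x = 0)"

end

theory Submission
  imports Defs
begin

text \<open>Put \<open>\<eta> = \<epsilon>\<^sup>1\<^sup>+\<^sup>\<alpha> / \<Delta>t\<close> and \<open>\<theta> = \<epsilon>\<^sup>1\<^sup>-\<^sup>\<alpha>\<close>. With the second one multiplied by \<open>\<eta>\<close>, the stage equations read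
  \<open>U = u\<^sup>n e - \<Delta>t A V\<^sub>x\<close> and \<open>\<eta> (V - v\<^sup>n e) = At (f(U) - \<theta> p(U)\<^sub>x) - A V\<close>, and nothing in them is singular
  any more. At \<open>\<eta> = 0\<close> the second one gives \<open>A V = At (f(U) - \<theta> p(U)\<^sub>x)\<close>; differentiating it in \<open>x\<close> and
  inserting the result into the first one eliminates \<open>V\<close> and leaves the stages of the explicit method
  with tableau \<open>At\<close> (\<open>imex_stages_zero_imp_explicit_stages\<close>). The limit of \<open>\<theta>\<close> is \<open>1\<close> for \<open>\<alpha> = 1\<close> and
  \<open>0\<close> for \<open>\<alpha> < 1\<close>, which decides whether the diffusion term survives. Global stiff accuracy says that
  the weights are the last rows of the tableaux, so that \<open>u\<^sup>n\<^sup>+\<^sup>1\<close> is the last component of \<open>U\<close>, before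
  and after the limit.

  The stages do converge as \<open>\<epsilon> \<rightarrow> 0\<close> (\<open>imex_stages_converge\<close>). Both tableaux are triangular, so stage \<open>i\<close>
  is an explicit expression in the earlier ones: \<open>V\<^sub>i\<close> is obtained by dividing by \<open>\<eta> + a\<^sub>i\<^sub>i\<close>, whose
  limit \<open>a\<^sub>i\<^sub>i\<close> is not \<open>0\<close>, and \<open>U\<^sub>i\<close> then follows from the \<open>x\<close>-derivatives of the \<open>V\<^sub>j\<close>. The exception is
  the first stage of a type II method, where both rows vanish and \<open>V\<^sub>1 = v\<^sup>n\<close> exactly. Each stage costs
  one derivative more than the previous ones, which does no harm if convergence means convergence
  of all derivatives; this notion is closed under sums, products, composition with a smooth function
  and \<open>d/dx\<close>. Conversely, the explicit stage equations have only one solution, again because \<open>At\<close> is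
  strictly triangular, so any solution of the limit scheme is the limit of the stages.\<close>

section \<open>Convergence with all space derivatives\<close>

text \<open>Pointwise convergence of the derivatives up to order \<open>k\<close>, one derivative at a time, so that closure
  properties follow by induction on \<open>k\<close> from the sum, product and chain rules without a formula for
  the \<open>k\<close>-th derivative. The members of the family are differentiable only eventually, and from a
  point on that may depend on \<open>k\<close>; families that agree eventually are thus interchangeable. A constant
  family converges to itself exactly when it is smooth, so closure properties of smooth functions are
  special cases.\<close>

fun tendsto_upto ::
    "nat \<Rightarrow> 'b filter \<Rightarrow> ('b \<Rightarrow> real \<Rightarrow> 'a::real_normed_vector) \<Rightarrow> (real \<Rightarrow> 'a) \<Rightarrow> bool" where
  "tendsto_upto 0 F G g \<longleftrightarrow>
     (\<forall>\<^sub>F e in F. \<forall>x. G e differentiable (at x)) \<and> (\<forall>x. g differentiable (at x)) \<and>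
     (\<forall>x. ((\<lambda>e. G e x) \<longlongrightarrow> g x) F)"
| "tendsto_upto (Suc k) F G g \<longleftrightarrow>
     tendsto_upto 0 F G g \<and> tendsto_upto k F (\<lambda>e. dx (G e)) (dx g)"

definition tendsto_smooth ::
    "'b filter \<Rightarrow> ('b \<Rightarrow> real \<Rightarrow> 'a::real_normed_vector) \<Rightarrow> (real \<Rightarrow> 'a) \<Rightarrow> bool" where
  "tendsto_smooth F G g \<longleftrightarrow> (\<forall>k. tendsto_upto k F G g)"

lemma has_vector_derivative_dx:
  "g differentiable (at x) \<Longrightarrow> (g has_vector_derivative dx g x) (at x)"
  unfolding dx_def by (simp add: vector_derivative_works)

lemma dx_eqI: "(\<And>x. (g has_vector_derivative g' x) (at x)) \<Longrightarrow> dx g = g'"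
  unfolding dx_def by (auto simp: vector_derivative_at)

lemma dx_const [simp]: "dx (\<lambda>x. c) = (\<lambda>x. 0)"
  by (rule dx_eqI) simp

lemma tendsto_upto_base: "tendsto_upto k F G g \<Longrightarrow> tendsto_upto 0 F G g"
  by (cases k) auto

lemma tendsto_upto_SucD: "tendsto_upto (Suc k) F G g \<Longrightarrow> tendsto_upto k F G g"
proof (induction k arbitrary: G g)
  case (Suc k)
  have "tendsto_upto (Suc k) F (\<lambda>e. dx (G e)) (dx g)"
    using Suc.prems unfolding tendsto_upto.simps(2)[of "Suc k"] by blast
  from Suc.IH[OF this] show ?case
    using Suc.prems by auto
qed auto

lemma tendsto_upto_cong:
  assumes "\<forall>\<^sub>F e in F. G e = H e" and "tendsto_upto k F G g"
  shows "tendsto_upto k F H g"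
  using assms
proof (induction k arbitrary: G H g)
  case 0
  have "((\<lambda>e. H e x) \<longlongrightarrow> g x) F" for x
  proof (rule Lim_transform_eventually)
    show "((\<lambda>e. G e x) \<longlongrightarrow> g x) F" using 0 by auto
    show "\<forall>\<^sub>F e in F. G e x = H e x" using 0(1) by eventually_elim simp
  qed
  moreover have "\<forall>\<^sub>F e in F. \<forall>x. G e differentiable (at x)" using 0 by auto
  then have "\<forall>\<^sub>F e in F. \<forall>x. H e differentiable (at x)"
    using 0(1) by eventually_elim simp
  ultimately show ?case using 0 by auto
next
  case (Suc k)
  have "tendsto_upto k F (\<lambda>e. dx (H e)) (dx g)"
  proof (rule Suc.IH)
    show "\<forall>\<^sub>F e in F. dx (G e) = dx (H e)" using Suc.prems(1) by eventually_elim simp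
    show "tendsto_upto k F (\<lambda>e. dx (G e)) (dx g)" using Suc.prems by simp
  qed
  moreover have "tendsto_upto k F H g"
    using Suc.IH[OF Suc.prems(1) tendsto_upto_SucD[OF Suc.prems(2)]] .
  ultimately show ?case using tendsto_upto_base by (simp only: tendsto_upto.simps(2)) blast
qed

text \<open>The form in which the rules of differentiation enter: they compute \<open>dx (G e)\<close> only for those \<open>e\<close> for
  which \<open>G e\<close> is differentiable.\<close>

lemma tendsto_upto_SucI:
  assumes "tendsto_upto 0 F G g" and "\<forall>\<^sub>F e in F. dx (G e) = G' e" and "dx g = g'"
    and "tendsto_upto k F G' g'"
  shows "tendsto_upto (Suc k) F G g"
proof -
  have "\<forall>\<^sub>F e in F. G' e = dx (G e)" using assms(2) by eventually_elim simp
  from tendsto_upto_cong[OF this assms(4)] show ?thesis using assms by simp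
qed

lemma tendsto_upto_const:
  assumes "(c \<longlongrightarrow> c0) F"
  shows "tendsto_upto k F (\<lambda>e x. c e) (\<lambda>x. c0)"
  using assms
proof (induction k arbitrary: c c0)
  case (Suc k)
  show ?case
    using Suc.IH[of "\<lambda>_. 0" 0] Suc.prems by simp
qed auto

lemma tendsto_upto_add:
  fixes g h :: "real \<Rightarrow> 'a::real_normed_vector"
  assumes "tendsto_upto k F G g" and "tendsto_upto k F H h"
  shows "tendsto_upto k F (\<lambda>e x. G e x + H e x) (\<lambda>x. g x + h x)"
proof -
  have base: "tendsto_upto 0 F (\<lambda>e x. G e x + H e x) (\<lambda>x. g x + h x)"
    if "tendsto_upto 0 F G g" "tendsto_upto 0 F H h" for G g H and h :: "real \<Rightarrow> 'a"
  proof -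
    have "\<forall>\<^sub>F e in F. \<forall>x. G e differentiable (at x)" "\<forall>\<^sub>F e in F. \<forall>x. H e differentiable (at x)"
      using that by auto
    then have "\<forall>\<^sub>F e in F. \<forall>x. (\<lambda>x. G e x + H e x) differentiable (at x)"
      by eventually_elim auto
    then show ?thesis using that by (auto intro!: tendsto_intros)
  qed
  have dsum: "dx (\<lambda>x. a x + b x) = (\<lambda>x. dx a x + dx b x)"
    if "\<forall>x. a differentiable (at x)" "\<forall>x. b differentiable (at x)" for a b :: "real \<Rightarrow> 'a"
    using that by (intro dx_eqI has_vector_derivative_add has_vector_derivative_dx) auto
  show ?thesis
    using assms
  proof (induction k arbitrary: G g H h)
    case 0
    then show ?case by (rule base)
  next
    case (Suc k)
    have ev: "\<forall>\<^sub>F e in F. \<forall>x. G e differentiable (at x)" "\<forall>\<^sub>F e in F. \<forall>x. H e differentiable (at x)"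
      using Suc.prems by auto
    show ?case
    proof (rule tendsto_upto_SucI)
      show "tendsto_upto 0 F (\<lambda>e x. G e x + H e x) (\<lambda>x. g x + h x)"
        using Suc.prems tendsto_upto_base by (intro base) blast+
      show "\<forall>\<^sub>F e in F. dx (\<lambda>x. G e x + H e x) = (\<lambda>x. dx (G e) x + dx (H e) x)"
        using ev by eventually_elim (rule dsum)
      show "dx (\<lambda>x. g x + h x) = (\<lambda>x. dx g x + dx h x)"
        using Suc.prems by (intro dsum) auto
      show "tendsto_upto k F (\<lambda>e x. dx (G e) x + dx (H e) x) (\<lambda>x. dx g x + dx h x)"
        using Suc.prems by (intro Suc.IH) auto
    qed
  qed
qed

text \<open>In the product rule each undifferentiated factor occurs with only \<open>k\<close> derivatives to control instead
  of \<open>k + 1\<close>; this is the downward step \<open>tendsto_upto_SucD\<close>. The chain rule below uses it in the same way.\<close>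

lemma tendsto_upto_mult:
  fixes g h :: "real \<Rightarrow> real"
  assumes "tendsto_upto k F G g" and "tendsto_upto k F H h"
  shows "tendsto_upto k F (\<lambda>e x. G e x * H e x) (\<lambda>x. g x * h x)"
proof -
  have base: "tendsto_upto 0 F (\<lambda>e x. G e x * H e x) (\<lambda>x. g x * h x)"
    if "tendsto_upto 0 F G g" "tendsto_upto 0 F H h" for G g H and h :: "real \<Rightarrow> real"
  proof -
    have "\<forall>\<^sub>F e in F. \<forall>x. G e differentiable (at x)" "\<forall>\<^sub>F e in F. \<forall>x. H e differentiable (at x)"
      using that by auto
    then have "\<forall>\<^sub>F e in F. \<forall>x. (\<lambda>x. G e x * H e x) differentiable (at x)"
      by eventually_elim (auto intro!: differentiable_mult)
    then show ?thesis using that by (auto intro!: tendsto_intros differentiable_mult)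
  qed
  have dprod: "dx (\<lambda>x. a x * b x) = (\<lambda>x. a x * dx b x + dx a x * b x)"
    if "\<forall>x. a differentiable (at x)" "\<forall>x. b differentiable (at x)" for a b :: "real \<Rightarrow> real"
    using that by (intro dx_eqI has_vector_derivative_mult has_vector_derivative_dx) auto
  show ?thesis
    using assms
  proof (induction k arbitrary: G g H h)
    case 0
    then show ?case by (rule base)
  next
    case (Suc k)
    have ev: "\<forall>\<^sub>F e in F. \<forall>x. G e differentiable (at x)" "\<forall>\<^sub>F e in F. \<forall>x. H e differentiable (at x)"
      using Suc.prems by auto
    show ?case
    proof (rule tendsto_upto_SucI)
      show "tendsto_upto 0 F (\<lambda>e x. G e x * H e x) (\<lambda>x. g x * h x)"
        using Suc.prems tendsto_upto_base by (intro base) blast+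
      show "\<forall>\<^sub>F e in F. dx (\<lambda>x. G e x * H e x) = (\<lambda>x. G e x * dx (H e) x + dx (G e) x * H e x)"
        using ev by eventually_elim (rule dprod)
      show "dx (\<lambda>x. g x * h x) = (\<lambda>x. g x * dx h x + dx g x * h x)"
        using Suc.prems by (intro dprod) auto
      show "tendsto_upto k F (\<lambda>e x. G e x * dx (H e) x + dx (G e) x * H e x)
              (\<lambda>x. g x * dx h x + dx g x * h x)"
        using Suc.prems tendsto_upto_SucD[OF Suc.prems(1)] tendsto_upto_SucD[OF Suc.prems(2)]
        by (intro tendsto_upto_add Suc.IH) auto
    qed
  qed
qed

lemma smooth_dx: "smooth g \<Longrightarrow> smooth (dx g)"
  unfolding smooth_def by (metis comp_apply funpow_Suc_right)

lemma smooth_differentiable: "smooth g \<Longrightarrow> g differentiable (at x)"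
  unfolding smooth_def by (metis funpow_0)

lemma tendsto_upto_compose:
  fixes f g :: "real \<Rightarrow> real"
  assumes "smooth f" and "tendsto_upto k F G g"
  shows "tendsto_upto k F (\<lambda>e x. f (G e x)) (\<lambda>x. f (g x))"
  using assms
proof (induction k arbitrary: f G g)
  case (0 f)
  have df: "f differentiable (at y)" for y by (rule smooth_differentiable[OF 0(1)])
  have comp: "(\<lambda>x. f (a x)) differentiable (at x)" if "a differentiable (at x)" for a x
    using differentiable_chain_at[OF that df] by (simp add: o_def)
  have "\<forall>\<^sub>F e in F. \<forall>x. G e differentiable (at x)" using 0 by auto
  then have "\<forall>\<^sub>F e in F. \<forall>x. (\<lambda>x. f (G e x)) differentiable (at x)"
    by eventually_elim (auto intro: comp)
  moreover have "((\<lambda>e. f (G e x)) \<longlongrightarrow> f (g x)) F" for x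
    using 0(2) by (intro isCont_tendsto_compose[OF differentiable_imp_continuous_within[OF df]]) auto
  ultimately show ?case using 0(2) by (auto intro: comp)
next
  case (Suc k f)
  have df: "f differentiable (at y)" for y by (rule smooth_differentiable[OF Suc.prems(1)])
  have base: "tendsto_upto k F (\<lambda>e x. f (G e x)) (\<lambda>x. f (g x))"
    by (rule Suc.IH[OF Suc.prems(1) tendsto_upto_SucD[OF Suc.prems(2)]])
  have ev: "\<forall>\<^sub>F e in F. \<forall>x. G e differentiable (at x)" using Suc.prems(2) by auto
  have dcomp: "dx (\<lambda>x. f (a x)) = (\<lambda>x. dx f (a x) * dx a x)"
    if "\<forall>x. a differentiable (at x)" for a
  proof (rule dx_eqI)
    fix x
    have "(f \<circ> a has_vector_derivative dx a x *\<^sub>R dx f (a x)) (at x)"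
      using that df by (intro vector_diff_chain_at has_vector_derivative_dx) auto
    then show "((\<lambda>x. f (a x)) has_vector_derivative dx f (a x) * dx a x) (at x)"
      by (simp add: o_def mult.commute)
  qed
  show ?case
  proof (rule tendsto_upto_SucI[OF tendsto_upto_base[OF base]])
    show "\<forall>\<^sub>F e in F. dx (\<lambda>x. f (G e x)) = (\<lambda>x. dx f (G e x) * dx (G e) x)"
      using ev by eventually_elim (rule dcomp)
    show "dx (\<lambda>x. f (g x)) = (\<lambda>x. dx f (g x) * dx g x)"
      using Suc.prems(2) by (intro dcomp) auto
    show "tendsto_upto k F (\<lambda>e x. dx f (G e x) * dx (G e) x) (\<lambda>x. dx f (g x) * dx g x)"
    proof (rule tendsto_upto_mult)
      show "tendsto_upto k F (\<lambda>e x. dx f (G e x)) (\<lambda>x. dx f (g x))"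
        by (rule Suc.IH[OF smooth_dx[OF Suc.prems(1)] tendsto_upto_SucD[OF Suc.prems(2)]])
      show "tendsto_upto k F (\<lambda>e. dx (G e)) (dx g)"
        using Suc.prems(2) by simp
    qed
  qed
qed

lemma differentiable_vec_nth:
  fixes g :: "real \<Rightarrow> real^'n"
  shows "g differentiable (at x) \<longleftrightarrow> (\<forall>i. (\<lambda>x. g x $ i) differentiable (at x))"
  by (subst differentiable_componentwise_within)
    (auto simp: Basis_vec_def inner_axis)

lemma dx_vec_nth:
  fixes g :: "real \<Rightarrow> real^'n"
  assumes "\<forall>x. g differentiable (at x)"
  shows "dx (\<lambda>x. g x $ i) = (\<lambda>x. dx g x $ i)"
  using assms
  by (intro dx_eqI bounded_linear.has_vector_derivative[OF bounded_linear_vec_nth]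
        has_vector_derivative_dx) auto

lemma tendsto_upto_vecI:
  fixes g :: "real \<Rightarrow> real^'n"
  assumes "\<And>i. tendsto_upto k F (\<lambda>e x. G e x $ i) (\<lambda>x. g x $ i)"
  shows "tendsto_upto k F G g"
  using assms
proof (induction k arbitrary: G g)
  case 0
  have "\<forall>\<^sub>F e in F. \<forall>i x. (\<lambda>x. G e x $ i) differentiable (at x)"
    using 0 by (intro eventually_all_finite) simp
  then have "\<forall>\<^sub>F e in F. \<forall>x. G e differentiable (at x)"
    by eventually_elim (simp add: differentiable_vec_nth[of "G _"])
  moreover have "\<forall>x. g differentiable (at x)"
    using 0 by (simp add: differentiable_vec_nth[of g])
  moreover have "((\<lambda>e. G e x) \<longlongrightarrow> g x) F" for x
    using 0 by (intro vec_tendstoI) simp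
  ultimately show ?case by simp
next
  case (Suc k)
  have base: "tendsto_upto k F G g"
    by (rule Suc.IH[OF tendsto_upto_SucD[OF Suc.prems]])
  have diff: "\<forall>\<^sub>F e in F. \<forall>x. G e differentiable (at x)" "\<forall>x. g differentiable (at x)"
    using tendsto_upto_base[OF base] by auto
  have "tendsto_upto k F (\<lambda>e. dx (G e)) (dx g)"
  proof (rule Suc.IH)
    fix i
    have "tendsto_upto k F (\<lambda>e. dx (\<lambda>x. G e x $ i)) (\<lambda>x. dx g x $ i)"
      using Suc.prems[of i] by (simp add: dx_vec_nth[OF diff(2)])
    moreover have "\<forall>\<^sub>F e in F. dx (\<lambda>x. G e x $ i) = (\<lambda>x. dx (G e) x $ i)"
      using diff(1) by eventually_elim (rule dx_vec_nth)
    ultimately show "tendsto_upto k F (\<lambda>e x. dx (G e) x $ i) (\<lambda>x. dx g x $ i)"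
      by (rule tendsto_upto_cong[rotated])
  qed
  then show ?case using tendsto_upto_base[OF base] by simp
qed

lemma tendsto_upto_vec_nth:
  fixes g :: "real \<Rightarrow> real^'n"
  assumes "tendsto_upto k F G g"
  shows "tendsto_upto k F (\<lambda>e x. G e x $ i) (\<lambda>x. g x $ i)"
  using assms
proof (induction k arbitrary: G g)
  case 0
  have "\<forall>\<^sub>F e in F. \<forall>x. G e differentiable (at x)" using 0 by auto
  then have "\<forall>\<^sub>F e in F. \<forall>x. (\<lambda>x. G e x $ i) differentiable (at x)"
    by eventually_elim (simp add: differentiable_vec_nth[of "G _"])
  moreover have "\<forall>x. (\<lambda>x. g x $ i) differentiable (at x)"
    using 0 differentiable_vec_nth by auto
  moreover have "((\<lambda>e. G e x $ i) \<longlongrightarrow> g x $ i) F" for x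
    using 0 by (intro tendsto_vec_nth) simp
  ultimately show ?case by simp
next
  case (Suc k)
  have base: "tendsto_upto k F (\<lambda>e x. G e x $ i) (\<lambda>x. g x $ i)"
    by (rule Suc.IH[OF tendsto_upto_SucD[OF Suc.prems]])
  have diff: "\<forall>\<^sub>F e in F. \<forall>x. G e differentiable (at x)" "\<forall>x. g differentiable (at x)"
    using Suc.prems by auto
  show ?case
  proof (rule tendsto_upto_SucI[OF tendsto_upto_base[OF base]])
    show "\<forall>\<^sub>F e in F. dx (\<lambda>x. G e x $ i) = (\<lambda>x. dx (G e) x $ i)"
      using diff(1) by eventually_elim (rule dx_vec_nth)
    show "dx (\<lambda>x. g x $ i) = (\<lambda>x. dx g x $ i)"
      by (rule dx_vec_nth[OF diff(2)])
    show "tendsto_upto k F (\<lambda>e x. dx (G e) x $ i) (\<lambda>x. dx g x $ i)"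
      using Suc.prems by (intro Suc.IH) simp
  qed
qed

lemma tendsto_upto_funpow_dx:
  assumes "tendsto_upto k F G g"
  shows "((\<lambda>e. (dx ^^ k) (G e) x) \<longlongrightarrow> (dx ^^ k) g x) F"
    and "(dx ^^ k) g differentiable (at x)"
  using assms by (induction k arbitrary: G g) (auto simp: funpow_swap1)

lemma tendsto_upto_ident: "smooth g \<Longrightarrow> tendsto_upto k F (\<lambda>_. g) g"
  by (induction k arbitrary: g) (simp_all add: smooth_dx smooth_differentiable)

lemma tendsto_smooth_imp_smooth: "tendsto_smooth F G g \<Longrightarrow> smooth g"
  by (simp add: tendsto_smooth_def smooth_def tendsto_upto_funpow_dx(2)[of _ F G])

lemma tendsto_smooth_ident_iff: "tendsto_smooth F (\<lambda>_. g) g \<longleftrightarrow> smooth g"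
  using tendsto_smooth_imp_smooth by (auto simp: tendsto_smooth_def tendsto_upto_ident)

lemma tendsto_smooth_imp_leading_order: "tendsto_smooth (at_right 0) G g \<Longrightarrow> leading_order G g"
  by (simp add: leading_order_def tendsto_smooth_imp_smooth)
    (simp add: tendsto_smooth_def tendsto_upto_funpow_dx(1))

lemma tendsto_smooth_tendsto: "tendsto_smooth F G g \<Longrightarrow> ((\<lambda>e. G e x) \<longlongrightarrow> g x) F"
  unfolding tendsto_smooth_def by (drule spec[of _ 0]) simp

lemma tendsto_smooth_dx: "tendsto_smooth F G g \<Longrightarrow> tendsto_smooth F (\<lambda>e. dx (G e)) (dx g)"
  by (simp add: tendsto_smooth_def) (metis tendsto_upto.simps(2))

lemma tendsto_smooth_cong:
  "\<forall>\<^sub>F e in F. G e = H e \<Longrightarrow> tendsto_smooth F G g \<Longrightarrow> tendsto_smooth F H g"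
  by (simp add: tendsto_smooth_def tendsto_upto_cong[of G H])

lemma tendsto_smooth_const: "(c \<longlongrightarrow> c0) F \<Longrightarrow> tendsto_smooth F (\<lambda>e x. c e) (\<lambda>x. c0)"
  by (simp add: tendsto_smooth_def tendsto_upto_const)

lemma tendsto_smooth_add:
  "tendsto_smooth F G g \<Longrightarrow> tendsto_smooth F H h \<Longrightarrow>
     tendsto_smooth F (\<lambda>e x. G e x + H e x) (\<lambda>x. g x + h x)"
  by (simp add: tendsto_smooth_def tendsto_upto_add)

lemma tendsto_smooth_mult:
  fixes g h :: "real \<Rightarrow> real"
  shows "tendsto_smooth F G g \<Longrightarrow> tendsto_smooth F H h \<Longrightarrow>
     tendsto_smooth F (\<lambda>e x. G e x * H e x) (\<lambda>x. g x * h x)"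
  by (simp add: tendsto_smooth_def tendsto_upto_mult)

lemma tendsto_smooth_cmult:
  fixes g :: "real \<Rightarrow> real"
  shows "(c \<longlongrightarrow> c0) F \<Longrightarrow> tendsto_smooth F G g \<Longrightarrow>
     tendsto_smooth F (\<lambda>e x. c e * G e x) (\<lambda>x. c0 * g x)"
  by (intro tendsto_smooth_mult tendsto_smooth_const)

lemma tendsto_smooth_diff:
  fixes g h :: "real \<Rightarrow> real"
  assumes "tendsto_smooth F G g" and "tendsto_smooth F H h"
  shows "tendsto_smooth F (\<lambda>e x. G e x - H e x) (\<lambda>x. g x - h x)"
  using tendsto_smooth_add[OF assms(1) tendsto_smooth_cmult[OF tendsto_const[of "-1"] assms(2)]]
  by simp

lemma tendsto_smooth_sum:
  fixes g :: "'i \<Rightarrow> real \<Rightarrow> real"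
  assumes "\<And>i. i \<in> S \<Longrightarrow> tendsto_smooth F (G i) (g i)"
  shows "tendsto_smooth F (\<lambda>e x. \<Sum>i\<in>S. G i e x) (\<lambda>x. \<Sum>i\<in>S. g i x)"
  using assms
proof (induction S rule: infinite_finite_induct)
  case (insert i S)
  have "tendsto_smooth F (\<lambda>e x. G i e x + (\<Sum>i\<in>S. G i e x)) (\<lambda>x. g i x + (\<Sum>i\<in>S. g i x))"
    by (rule tendsto_smooth_add) (simp_all add: insert)
  with insert show ?case by simp
qed (simp_all add: tendsto_smooth_const)

lemma tendsto_smooth_compose:
  fixes f g :: "real \<Rightarrow> real"
  shows "smooth f \<Longrightarrow> tendsto_smooth F G g \<Longrightarrow>
     tendsto_smooth F (\<lambda>e x. f (G e x)) (\<lambda>x. f (g x))"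
  by (simp add: tendsto_smooth_def tendsto_upto_compose[of f])

lemma tendsto_smooth_vecI:
  fixes g :: "real \<Rightarrow> real^'n"
  assumes "\<And>i. tendsto_smooth F (\<lambda>e x. G e x $ i) (\<lambda>x. g x $ i)"
  shows "tendsto_smooth F G g"
  using assms by (simp add: tendsto_smooth_def tendsto_upto_vecI[of _ F G g])

lemma tendsto_smooth_vec_nth:
  fixes g :: "real \<Rightarrow> real^'n"
  shows "tendsto_smooth F G g \<Longrightarrow> tendsto_smooth F (\<lambda>e x. G e x $ i) (\<lambda>x. g x $ i)"
  by (simp add: tendsto_smooth_def tendsto_upto_vec_nth)

lemma smooth_compose:
  fixes f g :: "real \<Rightarrow> real"
  assumes "smooth f" and "smooth g"
  shows "smooth (\<lambda>x. f (g x))"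
  using tendsto_smooth_compose[of f at_top "\<lambda>_. g" g] assms by (simp add: tendsto_smooth_ident_iff)

lemma smooth_vec_nth:
  fixes g :: "real \<Rightarrow> real^'n"
  assumes "smooth g"
  shows "smooth (\<lambda>x. g x $ i)"
  using tendsto_smooth_vec_nth[of at_top "\<lambda>_. g" g] assms by (simp add: tendsto_smooth_ident_iff)

lemma smooth_vecI:
  fixes g :: "real \<Rightarrow> real^'n"
  assumes "\<And>i. smooth (\<lambda>x. g x $ i)"
  shows "smooth g"
  using tendsto_smooth_vecI[of at_top "\<lambda>_. g" g] assms by (simp add: tendsto_smooth_ident_iff)

lemma smooth_dx_vec_nth:
  fixes g :: "real \<Rightarrow> real^'n"
  shows "smooth g \<Longrightarrow> dx g x $ i = dx (\<lambda>x. g x $ i) x"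
  by (simp add: dx_vec_nth smooth_differentiable)

section \<open>Lower triangular tableaux\<close>

text \<open>Forward substitution: if \<open>B\<close> is the inverse, then by induction on \<open>i\<close> its entries to the right of the
  diagonal vanish in all rows above \<open>i\<close>, so that \<open>(A B)\<^sub>i\<^sub>j\<close> for \<open>j \<ge> i\<close> is the single product
  \<open>a\<^sub>i\<^sub>i b\<^sub>i\<^sub>j\<close>. Taking \<open>j = i\<close> gives \<open>a\<^sub>i\<^sub>i b\<^sub>i\<^sub>i = 1\<close>, and \<open>j > i\<close> gives \<open>b\<^sub>i\<^sub>j = 0\<close>.\<close>

lemma submatrix_invertible_imp_diagonal_nonzero:
  fixes A :: "real^'s::{finite,wellorder}^'s::{finite,wellorder}"
  assumes lower: "\<And>i j. i < j \<Longrightarrow> A $ i $ j = 0"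
    and inv: "submatrix_invertible S A" and "i \<in> S"
  shows "A $ i $ i \<noteq> 0"
proof -
  obtain B :: "real^'s::_^'s::_"
    where B: "\<And>i j. i \<in> S \<Longrightarrow> j \<in> S \<Longrightarrow> (\<Sum>k\<in>S. A $ i $ k * B $ k $ j) = (if i = j then 1 else 0)"
    using inv unfolding submatrix_invertible_def by blast
  have "A $ i $ i \<noteq> 0 \<and> (\<forall>j\<in>S. i < j \<longrightarrow> B $ i $ j = 0)"
    using \<open>i \<in> S\<close>
  proof (induction i rule: less_induct)
    case (less i)
    have row: "A $ i $ i * B $ i $ j = (if i = j then 1 else 0)" if "j \<in> S" "i \<le> j" for j
    proof -
      have "(\<Sum>k\<in>S. A $ i $ k * B $ k $ j) = (\<Sum>k\<in>{i}. A $ i $ k * B $ k $ j)"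
      proof (rule sum.mono_neutral_right)
        show "\<forall>k\<in>S - {i}. A $ i $ k * B $ k $ j = 0"
        proof
          fix k assume "k \<in> S - {i}"
          then consider "i < k" | "k \<in> S" "k < i" by force
          then show "A $ i $ k * B $ k $ j = 0"
            using less.IH[of k] lower[of i k] that by cases auto
        qed
      qed (use less.prems in auto)
      then show ?thesis using B[OF less.prems that(1)] by simp
    qed
    have "A $ i $ i \<noteq> 0" using row[of i] less.prems by auto
    moreover have "B $ i $ j = 0" if "j \<in> S" "i < j" for j
      using row[OF that(1) less_imp_le[OF that(2)]] that(2) \<open>A $ i $ i \<noteq> 0\<close>
      by (metis less_irrefl mult_eq_0_iff)
    ultimately show ?case by blast
  qed
  then show ?thesis ..
qed

lemma invertible_imp_submatrix_invertible_UNIV: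
  assumes "invertible A"
  shows "submatrix_invertible UNIV A"
proof -
  obtain B where "A ** B = mat 1" "B ** A = mat 1"
    using assms unfolding invertible_def by blast
  then show ?thesis
    unfolding submatrix_invertible_def matrix_matrix_mult_def mat_def vec_eq_iff
    by (intro exI[of _ B]) simp
qed

text \<open>What the two types have in common and the convergence proof rests on. In type II
  the first row of \<open>At\<close> vanishes as well, because \<open>At\<close> is strictly lower triangular.\<close>

lemma row_trivial_or_diagonal_nonzero:
  fixes At A :: "real^'s::{finite,wellorder}^'s::{finite,wellorder}"
  assumes tab: "imex_tableaux At A" and ty: "type_I A \<or> type_II A"
  shows "A $ i $ i \<noteq> 0 \<or> (\<forall>j. A $ i $ j = 0 \<and> At $ i $ j = 0)"
proof -
  have lower: "A $ i $ j = 0" if "i < j" for i j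
    using tab that unfolding imex_tableaux_def by blast
  show ?thesis
  proof (cases "type_I A")
    case True
    then show ?thesis
      using submatrix_invertible_imp_diagonal_nonzero[OF lower, where S = UNIV]
        invertible_imp_submatrix_invertible_UNIV unfolding type_I_def by blast
  next
    case False
    with ty have II: "type_II A" by blast
    show ?thesis
    proof (cases "i = first_stage")
      case True
      then have "i \<le> j" for j by (simp add: first_stage_def)
      then show ?thesis
        using True II tab unfolding type_II_def imex_tableaux_def row_def
        by (auto simp: vec_eq_iff)
    next
      case False
      then show ?thesis
        using submatrix_invertible_imp_diagonal_nonzero[OF lower] II unfolding type_II_def by blast
    qed
  qed
qed

section \<open>The limiting explicit scheme\<close>

text \<open>The stages of the explicit method for \<open>\<partial>\<^sub>t u + \<partial>\<^sub>x f(u) = \<theta> \<partial>\<^sub>x\<^sub>x p(u)\<close>. The parameter \<open>\<theta>\<close> allows one to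
  treat both limit equations at once; \<open>\<theta>\<close> is \<open>1\<close> for convection-diffusion and \<open>0\<close> for the conservation
  law.\<close>

definition explicit_stages ::
    "real^'s^'s \<Rightarrow> (real \<Rightarrow> real) \<Rightarrow> (real \<Rightarrow> real) \<Rightarrow> real \<Rightarrow> real \<Rightarrow> (real \<Rightarrow> real) \<Rightarrow>
     (real \<Rightarrow> real^'s) \<Rightarrow> bool" where
  "explicit_stages At f p \<theta> \<Delta>t un W \<longleftrightarrow>
     (\<forall>i x. W x $ i = un x - \<Delta>t * (\<Sum>j\<in>UNIV. At $ i $ j *
        (dx (\<lambda>x. f (W x $ j)) x - \<theta> * dx (dx (\<lambda>x. p (W x $ j))) x)))"

text \<open>The right-hand side for stage \<open>i\<close> involves only stages before \<open>i\<close>. The induction compares stages as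
  functions of \<open>x\<close>, since the right-hand side contains their derivatives.\<close>

lemma explicit_stages_unique:
  fixes At :: "real^'s::{finite,wellorder}^'s::{finite,wellorder}"
  assumes strict: "\<And>i j. i \<le> j \<Longrightarrow> At $ i $ j = 0"
    and "explicit_stages At f p \<theta> \<Delta>t un W" and "explicit_stages At f p \<theta> \<Delta>t un W'"
  shows "W = W'"
proof -
  have "(\<lambda>x. W x $ i) = (\<lambda>x. W' x $ i)" for i
  proof (induction i rule: less_induct)
    case (less i)
    let ?R = "\<lambda>W j x. At $ i $ j * (dx (\<lambda>x. f (W x $ j)) x - \<theta> * dx (dx (\<lambda>x. p (W x $ j))) x)"
    have R: "?R W j x = ?R W' j x" for j x
    proof (cases "j < i")
      case True
      from fun_cong[OF less.IH[OF this]] show ?thesis by simp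
    qed (simp add: strict not_less)
    show ?case
    proof
      fix x
      have "W x $ i = un x - \<Delta>t * (\<Sum>j\<in>UNIV. ?R W j x)"
        using assms(2) unfolding explicit_stages_def by blast
      also have "\<dots> = un x - \<Delta>t * (\<Sum>j\<in>UNIV. ?R W' j x)"
        unfolding R ..
      also have "\<dots> = W' x $ i"
        using assms(3) unfolding explicit_stages_def by (elim allE[of _ i] allE[of _ x]) (rule sym)
      finally show "W x $ i = W' x $ i" .
    qed
  qed
  then show ?thesis by (auto simp: fun_eq_iff vec_eq_iff)
qed

lemma dx_stagewise:
  assumes "smooth h" and "smooth W"
  shows "dx (stagewise h W) x $ j = dx (\<lambda>x. h (W x $ j)) x"
    and "dx (dx (stagewise h W)) x $ j = dx (dx (\<lambda>x. h (W x $ j))) x"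
proof -
  have sm: "smooth (stagewise h W)"
    using smooth_compose[OF assms(1) smooth_vec_nth[OF assms(2)]]
    by (intro smooth_vecI) (simp add: stagewise_def)
  show *: "dx (stagewise h W) x $ j = dx (\<lambda>x. h (W x $ j)) x" for x
    using smooth_dx_vec_nth[OF sm] by (simp add: stagewise_def)
  show "dx (dx (stagewise h W)) x $ j = dx (dx (\<lambda>x. h (W x $ j))) x"
    using smooth_dx_vec_nth[OF smooth_dx[OF sm]] by (simp add: *)
qed

text \<open>With the weights equal to the last row of the tableau, the update formula is the equation of the
  last stage.\<close>

lemma rk_equations_iff_explicit_stages:
  fixes At :: "real^'s::{finite,wellorder}^'s::{finite,wellorder}" and bt :: "real^'s::_"
    and W :: "real \<Rightarrow> real^'s::_" 
  assumes "\<Delta>t > 0" and "smooth f" and "smooth p" and "smooth W"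
    and bt: "\<And>i. At $ last_stage $ i = bt $ i"
  shows "(\<forall>x. (W x - un x *\<^sub>R vec 1) /\<^sub>R \<Delta>t + At *v dx (stagewise f W) x
            = \<theta> *\<^sub>R (At *v dx (dx (stagewise p W)) x)) \<and>
         (\<forall>x. (w x - un x) / \<Delta>t + bt \<bullet> dx (stagewise f W) x
            = \<theta> * (bt \<bullet> dx (dx (stagewise p W)) x)) \<longleftrightarrow>
         explicit_stages At f p \<theta> \<Delta>t un W \<and> w = (\<lambda>x. W x $ last_stage)"
    (is "?stages \<and> ?update \<longleftrightarrow> _")
proof -
  have solve: "(a - c) / \<Delta>t + q = \<theta> * r \<longleftrightarrow> a = c - \<Delta>t * (q - \<theta> * r)" for a c q r :: real
    using \<open>\<Delta>t > 0\<close> by (auto simp: field_simps)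
  define R where "R i x = (\<Sum>j\<in>UNIV. At $ i $ j *
        (dx (\<lambda>x. f (W x $ j)) x - \<theta> * dx (dx (\<lambda>x. p (W x $ j))) x))" for i x
  have R: "R i x = (\<Sum>j\<in>UNIV. At $ i $ j * dx (stagewise f W) x $ j)
      - \<theta> * (\<Sum>j\<in>UNIV. At $ i $ j * dx (dx (stagewise p W)) x $ j)" for i x
    using assms unfolding R_def
    by (simp add: dx_stagewise sum_subtractf sum_distrib_left algebra_simps)
  have st: "?stages \<longleftrightarrow> (\<forall>i x. W x $ i = un x - \<Delta>t * R i x)"
    unfolding vec_eq_iff R solve[symmetric]
    by (auto simp: matrix_vector_mult_def divide_inverse mult.commute)
  have up: "?update \<longleftrightarrow> (\<forall>x. w x = un x - \<Delta>t * R last_stage x)"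
    unfolding R solve[symmetric] by (simp add: inner_vec_def bt)
  have ex: "explicit_stages At f p \<theta> \<Delta>t un W \<longleftrightarrow> (\<forall>i x. W x $ i = un x - \<Delta>t * R i x)"
    unfolding explicit_stages_def R_def ..
  show ?thesis
    unfolding st up ex by (auto simp: fun_eq_iff)
qed

section \<open>The rescaled IMEX stages\<close>

text \<open>The stage equations after multiplication by \<open>\<eta>\<close>. They make sense at \<open>\<eta> = 0\<close>, where they are the reduced
  scheme.\<close>

definition imex_stages ::
    "real^'s^'s \<Rightarrow> real^'s^'s \<Rightarrow> (real \<Rightarrow> real) \<Rightarrow> (real \<Rightarrow> real) \<Rightarrow> real \<Rightarrow> real \<Rightarrow> real \<Rightarrow>
     (real \<Rightarrow> real) \<Rightarrow> (real \<Rightarrow> real) \<Rightarrow> (real \<Rightarrow> real^'s) \<Rightarrow> (real \<Rightarrow> real^'s) \<Rightarrow> bool" where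
  "imex_stages At A f p \<Delta>t \<eta> \<theta> un vn U V \<longleftrightarrow>
     smooth U \<and> smooth V \<and>
     (\<forall>i x. U x $ i = un x - \<Delta>t * (\<Sum>j\<in>UNIV. A $ i $ j * dx (\<lambda>x. V x $ j) x)) \<and>
     (\<forall>i x. \<eta> * (V x $ i - vn x) =
        (\<Sum>j\<in>UNIV. At $ i $ j * (f (U x $ j) - \<theta> * dx (\<lambda>x. p (U x $ j)) x))
        - (\<Sum>j\<in>UNIV. A $ i $ j * V x $ j))"

lemma imex_step_imp_imex_stages:
  fixes At A :: "real^'s::{finite,wellorder}^'s::{finite,wellorder}" and bt b :: "real^'s::_"
    and U V :: "real \<Rightarrow> real^'s::_"
  assumes "\<epsilon> > 0" and "\<Delta>t > 0" and "smooth p"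
    and step: "imex_step At bt A b f p \<alpha> \<Delta>t \<epsilon> un vn U V u1 v1"
  shows "imex_stages At A f p \<Delta>t (\<epsilon> powr (1 + \<alpha>) / \<Delta>t) (\<epsilon> powr (1 - \<alpha>)) un vn U V"
proof -
  have smU: "smooth U" and smV: "smooth V"
    and Ueq: "\<And>x. U x = un x *\<^sub>R vec 1 - \<Delta>t *\<^sub>R (A *v dx V x)"
    and Veq: "\<And>x. V x = vn x *\<^sub>R vec 1
        - (\<Delta>t / \<epsilon> powr (1 + \<alpha>)) *\<^sub>R
            (At *v (\<epsilon> powr (1 - \<alpha>) *\<^sub>R dx (stagewise p U) x - stagewise f U x))
        - (\<Delta>t / \<epsilon> powr (1 + \<alpha>)) *\<^sub>R (A *v V x)"
    using step unfolding imex_step_def by auto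
  have "U x $ i = un x - \<Delta>t * (\<Sum>j\<in>UNIV. A $ i $ j * dx (\<lambda>x. V x $ j) x)" for i x
    using arg_cong[OF Ueq, of "\<lambda>w. w $ i" x]
    by (simp add: matrix_vector_mult_def smooth_dx_vec_nth[OF smV])
  moreover have "\<epsilon> powr (1 + \<alpha>) / \<Delta>t * (V x $ i - vn x) =
      (\<Sum>j\<in>UNIV. At $ i $ j * (f (U x $ j) - \<epsilon> powr (1 - \<alpha>) * dx (\<lambda>x. p (U x $ j)) x))
        - (\<Sum>j\<in>UNIV. A $ i $ j * V x $ j)" for i x
  proof -
    define q where "q = \<epsilon> powr (1 + \<alpha>)"
    have q: "q > 0" using \<open>\<epsilon> > 0\<close> by (simp add: q_def)
    define S where "S = (\<Sum>j\<in>UNIV. At $ i $ j * (f (U x $ j) - \<epsilon> powr (1 - \<alpha>) * dx (\<lambda>x. p (U x $ j)) x))"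
    define T where "T = (\<Sum>j\<in>UNIV. A $ i $ j * V x $ j)"
    have "(At *v (\<epsilon> powr (1 - \<alpha>) *\<^sub>R dx (stagewise p U) x - stagewise f U x)) $ i = - S"
    proof -
      have "stagewise f U x $ j = f (U x $ j)" for j by (simp add: stagewise_def)
      then show ?thesis
        unfolding S_def matrix_vector_mult_def
        by (simp add: dx_stagewise[OF \<open>smooth p\<close> smU] sum_negf[symmetric] algebra_simps)
    qed
    moreover have "(A *v V x) $ i = T"
      unfolding T_def matrix_vector_mult_def by simp
    ultimately have "V x $ i - vn x = \<Delta>t / q * (S - T)"
      using arg_cong[OF Veq, of "\<lambda>w. w $ i" x] by (simp add: q_def right_diff_distrib)
    then show ?thesis
      using q \<open>\<Delta>t > 0\<close> unfolding S_def[symmetric] T_def[symmetric] q_def[symmetric] by simp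
  qed
  ultimately show ?thesis unfolding imex_stages_def using smU smV by blast
qed

lemma sum_lower_triangular:
  fixes i :: "'s::{finite,wellorder}" and c :: "'s \<Rightarrow> real"
  assumes "\<And>j. i < j \<Longrightarrow> c j = 0"
  shows "(\<Sum>j\<in>UNIV. c j) = c i + (\<Sum>j\<in>{..<i}. c j)"
proof -
  have "(\<Sum>j\<in>UNIV. c j) = (\<Sum>j\<in>insert i {..<i}. c j)"
    by (rule sum.mono_neutral_right) (auto intro!: assms simp: not_less le_less)
  then show ?thesis by simp
qed

text \<open>Stages converge one after the other. The hypothesis \<open>\<eta> \<noteq> 0\<close> serves the rows that vanish: there
  the second equation is \<open>\<eta> (V\<^sub>i - v\<^sup>n) = 0\<close>, which determines \<open>V\<^sub>i\<close> before the limit but says nothing at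
  \<open>\<eta> = 0\<close>.\<close>

lemma imex_stages_converge:
  fixes At A :: "real^'s::{finite,wellorder}^'s::{finite,wellorder}"
    and U V :: "'b \<Rightarrow> real \<Rightarrow> real^'s::_"
  assumes tab: "imex_tableaux At A"
    and diag: "\<And>i. A $ i $ i \<noteq> 0 \<or> (\<forall>j. A $ i $ j = 0 \<and> At $ i $ j = 0)"
    and sm: "smooth f" "smooth p" "smooth un" "smooth vn"
    and \<eta>: "(\<eta> \<longlongrightarrow> 0) F" "\<forall>\<^sub>F e in F. \<eta> e \<noteq> 0" and \<theta>: "(\<theta> \<longlongrightarrow> \<theta>0) F"
    and stages: "\<forall>\<^sub>F e in F. imex_stages At A f p \<Delta>t (\<eta> e) (\<theta> e) un vn (U e) (V e)"
  shows "\<exists>U0 V0. tendsto_smooth F U U0 \<and> tendsto_smooth F V V0"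
proof -
  have A: "A $ i $ j = 0" if "i < j" for i j
    using tab that unfolding imex_tableaux_def by blast
  have At: "At $ i $ j = 0" if "i \<le> j" for i j
    using tab that unfolding imex_tableaux_def by blast
  have un: "tendsto_smooth F (\<lambda>e. un) un" and vn: "tendsto_smooth F (\<lambda>e. vn) vn"
    using sm by (simp_all add: tendsto_smooth_ident_iff)
  have "\<exists>u v. tendsto_smooth F (\<lambda>e x. U e x $ i) u \<and> tendsto_smooth F (\<lambda>e x. V e x $ i) v" for i
  proof (induction i rule: less_induct)
    case (less i)
    then obtain u v where u: "\<And>j. j < i \<Longrightarrow> tendsto_smooth F (\<lambda>e x. U e x $ j) (u j)"
      and v: "\<And>j. j < i \<Longrightarrow> tendsto_smooth F (\<lambda>e x. V e x $ j) (v j)"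
      by metis
    note fu = tendsto_smooth_compose[OF sm(1) u]
    note pu = tendsto_smooth_dx[OF tendsto_smooth_compose[OF sm(2) u]]
    have "\<exists>v. tendsto_smooth F (\<lambda>e x. V e x $ i) v"
    proof (cases "A $ i $ i = 0")
      case True
      then have zero: "A $ i $ j = 0" "At $ i $ j = 0" for j using diag[of i] by auto
      have "\<forall>\<^sub>F e in F. vn = (\<lambda>x. V e x $ i)"
        using stages \<eta>(2)
      proof eventually_elim
        case (elim e)
        then have "\<eta> e * (V e x $ i - vn x) = 0" for x
          unfolding imex_stages_def by (simp add: zero)
        with elim(2) show ?case by (auto simp: fun_eq_iff)
      qed
      from tendsto_smooth_cong[OF this vn] show ?thesis by (rule exI[of _ vn])
    next
      case False
      \<comment> \<open>the second stage equation solved for \<open>(\<eta> + a\<^sub>i\<^sub>i) V\<^sub>i\<close>; by triangularity only stages before \<open>i\<close> occur\<close>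
      define rhs where "rhs e x = \<eta> e * vn x
          + (\<Sum>j\<in>{..<i}. At $ i $ j * (f (U e x $ j) - \<theta> e * dx (\<lambda>x. p (U e x $ j)) x))
          - (\<Sum>j\<in>{..<i}. A $ i $ j * V e x $ j)" for e x
      have lim: "((\<lambda>e. \<eta> e + A $ i $ i) \<longlongrightarrow> A $ i $ i) F"
        using tendsto_add[OF \<eta>(1) tendsto_const] by simp
      have "\<forall>\<^sub>F e in F. \<eta> e + A $ i $ i \<noteq> 0"
        using tendsto_imp_eventually_ne[OF lim False] .
      then have "\<forall>\<^sub>F e in F. (\<lambda>x. inverse (\<eta> e + A $ i $ i) * rhs e x) = (\<lambda>x. V e x $ i)"
        using stages
      proof eventually_elim
        case (elim e)
        have "(\<eta> e + A $ i $ i) * V e x $ i = rhs e x" for x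
        proof -
          have "\<eta> e * (V e x $ i - vn x) =
              (\<Sum>j\<in>UNIV. At $ i $ j * (f (U e x $ j) - \<theta> e * dx (\<lambda>x. p (U e x $ j)) x))
              - (\<Sum>j\<in>UNIV. A $ i $ j * V e x $ j)"
            using elim(2) unfolding imex_stages_def by blast
          then show ?thesis
            unfolding rhs_def by (simp add: sum_lower_triangular[of i] A At algebra_simps)
        qed
        with elim(1) show ?case by (auto simp: fun_eq_iff field_simps)
      qed
      moreover have "tendsto_smooth F (\<lambda>e x. inverse (\<eta> e + A $ i $ i) * rhs e x)
          (\<lambda>x. inverse (A $ i $ i) * (0 * vn x
            + (\<Sum>j\<in>{..<i}. At $ i $ j * (f (u j x) - \<theta>0 * dx (\<lambda>x. p (u j x)) x))
            - (\<Sum>j\<in>{..<i}. A $ i $ j * v j x)))"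
        unfolding rhs_def
        by (intro tendsto_smooth_cmult tendsto_smooth_diff tendsto_smooth_add tendsto_smooth_sum
            fu pu v vn \<eta> \<theta> tendsto_const tendsto_inverse lim False) auto
      ultimately show ?thesis by (intro exI) (rule tendsto_smooth_cong)
    qed
    then obtain v' where v': "tendsto_smooth F (\<lambda>e x. V e x $ i) v'" by blast
    \<comment> \<open>the diagonal term is kept apart, since its limit comes from this step and not from the induction\<close>
    have "\<forall>\<^sub>F e in F. (\<lambda>x. un x - \<Delta>t * (A $ i $ i * dx (\<lambda>x. V e x $ i) x
        + (\<Sum>j\<in>{..<i}. A $ i $ j * dx (\<lambda>x. V e x $ j) x))) = (\<lambda>x. U e x $ i)"
      using stages
    proof eventually_elim
      case (elim e)
      then have "U e x $ i = un x - \<Delta>t * (\<Sum>j\<in>UNIV. A $ i $ j * dx (\<lambda>x. V e x $ j) x)" for x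
        unfolding imex_stages_def by blast
      then show ?case by (simp add: sum_lower_triangular[of i] A)
    qed
    moreover have "tendsto_smooth F (\<lambda>e x. un x - \<Delta>t * (A $ i $ i * dx (\<lambda>x. V e x $ i) x
        + (\<Sum>j\<in>{..<i}. A $ i $ j * dx (\<lambda>x. V e x $ j) x)))
      (\<lambda>x. un x - \<Delta>t * (A $ i $ i * dx v' x + (\<Sum>j\<in>{..<i}. A $ i $ j * dx (v j) x)))"
      by (intro tendsto_smooth_cmult tendsto_smooth_diff tendsto_smooth_add tendsto_smooth_sum
            tendsto_smooth_dx un v v' tendsto_const) auto
    ultimately have "tendsto_smooth F (\<lambda>e x. U e x $ i)
      (\<lambda>x. un x - \<Delta>t * (A $ i $ i * dx v' x + (\<Sum>j\<in>{..<i}. A $ i $ j * dx (v j) x)))"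
      by (rule tendsto_smooth_cong)
    with v' show ?case by blast
  qed
  then obtain u v where "\<And>i. tendsto_smooth F (\<lambda>e x. U e x $ i) (u i)"
    and "\<And>i. tendsto_smooth F (\<lambda>e x. V e x $ i) (v i)" by metis
  then have "tendsto_smooth F U (\<lambda>x. \<chi> i. u i x)" "tendsto_smooth F V (\<lambda>x. \<chi> i. v i x)"
    by (auto intro: tendsto_smooth_vecI)
  then show ?thesis by blast
qed

lemma imex_stages_limit:
  fixes At A :: "real^'s::finite^'s::finite" and U V :: "'b \<Rightarrow> real \<Rightarrow> real^'s::_"
  assumes "F \<noteq> bot" and sm: "smooth f" "smooth p"
    and \<eta>: "(\<eta> \<longlongrightarrow> \<eta>0) F" and \<theta>: "(\<theta> \<longlongrightarrow> \<theta>0) F"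
    and stages: "\<forall>\<^sub>F e in F. imex_stages At A f p \<Delta>t (\<eta> e) (\<theta> e) un vn (U e) (V e)"
    and U: "tendsto_smooth F U U0" and V: "tendsto_smooth F V V0"
  shows "imex_stages At A f p \<Delta>t \<eta>0 \<theta>0 un vn U0 V0"
proof -
  have u: "tendsto_smooth F (\<lambda>e x. U e x $ i) (\<lambda>x. U0 x $ i)" for i
    by (rule tendsto_smooth_vec_nth[OF U])
  have v: "tendsto_smooth F (\<lambda>e x. V e x $ i) (\<lambda>x. V0 x $ i)" for i
    by (rule tendsto_smooth_vec_nth[OF V])
  note lims = tendsto_smooth_tendsto[OF u] tendsto_smooth_tendsto[OF v]
    tendsto_smooth_tendsto[OF tendsto_smooth_dx[OF v]]
    tendsto_smooth_tendsto[OF tendsto_smooth_compose[OF sm(1) u]]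
    tendsto_smooth_tendsto[OF tendsto_smooth_dx[OF tendsto_smooth_compose[OF sm(2) u]]]
  have limit_eq: "l = r" if "(L \<longlongrightarrow> l) F" "(R \<longlongrightarrow> r) F" "\<forall>\<^sub>F e in F. L e = R e"
    for L R :: "'b \<Rightarrow> real" and l r
    using that tendsto_unique[OF \<open>F \<noteq> bot\<close>] Lim_transform_eventually by blast
  have "U0 x $ i = un x - \<Delta>t * (\<Sum>j\<in>UNIV. A $ i $ j * dx (\<lambda>x. V0 x $ j) x)" for i x
  proof (rule limit_eq)
    show "((\<lambda>e. U e x $ i) \<longlongrightarrow> U0 x $ i) F" by (rule lims)
    show "((\<lambda>e. un x - \<Delta>t * (\<Sum>j\<in>UNIV. A $ i $ j * dx (\<lambda>x. V e x $ j) x)) \<longlongrightarrow>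
        un x - \<Delta>t * (\<Sum>j\<in>UNIV. A $ i $ j * dx (\<lambda>x. V0 x $ j) x)) F"
      by (intro tendsto_intros lims)
    show "\<forall>\<^sub>F e in F. U e x $ i = un x - \<Delta>t * (\<Sum>j\<in>UNIV. A $ i $ j * dx (\<lambda>x. V e x $ j) x)"
      using stages by eventually_elim (simp add: imex_stages_def)
  qed
  moreover have "\<eta>0 * (V0 x $ i - vn x) =
        (\<Sum>j\<in>UNIV. At $ i $ j * (f (U0 x $ j) - \<theta>0 * dx (\<lambda>x. p (U0 x $ j)) x))
        - (\<Sum>j\<in>UNIV. A $ i $ j * V0 x $ j)" for i x
  proof (rule limit_eq)
    show "((\<lambda>e. \<eta> e * (V e x $ i - vn x)) \<longlongrightarrow> \<eta>0 * (V0 x $ i - vn x)) F"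
      by (intro tendsto_intros lims \<eta>)
    show "((\<lambda>e. (\<Sum>j\<in>UNIV. At $ i $ j * (f (U e x $ j) - \<theta> e * dx (\<lambda>x. p (U e x $ j)) x))
        - (\<Sum>j\<in>UNIV. A $ i $ j * V e x $ j)) \<longlongrightarrow>
        (\<Sum>j\<in>UNIV. At $ i $ j * (f (U0 x $ j) - \<theta>0 * dx (\<lambda>x. p (U0 x $ j)) x))
        - (\<Sum>j\<in>UNIV. A $ i $ j * V0 x $ j)) F"
      by (intro tendsto_intros lims \<theta>)
    show "\<forall>\<^sub>F e in F. \<eta> e * (V e x $ i - vn x) =
        (\<Sum>j\<in>UNIV. At $ i $ j * (f (U e x $ j) - \<theta> e * dx (\<lambda>x. p (U e x $ j)) x))
        - (\<Sum>j\<in>UNIV. A $ i $ j * V e x $ j)"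
      using stages by eventually_elim (simp add: imex_stages_def)
  qed
  ultimately show ?thesis
    unfolding imex_stages_def
    using tendsto_smooth_imp_smooth[OF U] tendsto_smooth_imp_smooth[OF V] by blast
qed

text \<open>At \<open>\<eta> = 0\<close> the second equation expresses \<open>A V\<close>, and \<open>V\<close> enters the first one only through the derivative
  of \<open>A V\<close>. Eliminating this product, and not \<open>V\<close> itself, treats singular and invertible \<open>A\<close> alike.\<close>

lemma imex_stages_zero_imp_explicit_stages:
  fixes At A :: "real^'s::finite^'s::finite"
  assumes sm: "smooth f" "smooth p"
    and stages: "imex_stages At A f p \<Delta>t 0 \<theta> un vn U V"
  shows "explicit_stages At f p \<theta> \<Delta>t un U"
proof -
  have smU: "smooth U" and smV: "smooth V"
    and Ueq: "\<And>i x. U x $ i = un x - \<Delta>t * (\<Sum>j\<in>UNIV. A $ i $ j * dx (\<lambda>x. V x $ j) x)"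
    and Veq: "\<And>i x. (\<Sum>j\<in>UNIV. A $ i $ j * V x $ j) =
        (\<Sum>j\<in>UNIV. At $ i $ j * (f (U x $ j) - \<theta> * dx (\<lambda>x. p (U x $ j)) x))"
    using stages unfolding imex_stages_def by auto
  have D: "(g has_vector_derivative dx g x) (at x)" if "smooth g" for g :: "real \<Rightarrow> real" and x
    using that by (intro has_vector_derivative_dx smooth_differentiable)
  note D_V = D[OF smooth_vec_nth[OF smV]]
    and D_f = D[OF smooth_compose[OF sm(1) smooth_vec_nth[OF smU]]]
    and D_p = D[OF smooth_dx[OF smooth_compose[OF sm(2) smooth_vec_nth[OF smU]]]]
  have eq: "(\<Sum>j\<in>UNIV. A $ i $ j * dx (\<lambda>x. V x $ j) x) =
      (\<Sum>j\<in>UNIV. At $ i $ j * (dx (\<lambda>x. f (U x $ j)) x - \<theta> * dx (dx (\<lambda>x. p (U x $ j))) x))" for i x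
  proof -
    have "((\<lambda>x. \<Sum>j\<in>UNIV. A $ i $ j * V x $ j) has_vector_derivative
        (\<Sum>j\<in>UNIV. A $ i $ j * dx (\<lambda>x. V x $ j) x)) (at x)"
      by (intro has_vector_derivative_sum has_vector_derivative_mult_right D_V)
    moreover have "((\<lambda>x. \<Sum>j\<in>UNIV. At $ i $ j * (f (U x $ j) - \<theta> * dx (\<lambda>x. p (U x $ j)) x))
        has_vector_derivative
        (\<Sum>j\<in>UNIV. At $ i $ j * (dx (\<lambda>x. f (U x $ j)) x - \<theta> * dx (dx (\<lambda>x. p (U x $ j))) x))) (at x)"
      by (intro has_vector_derivative_sum has_vector_derivative_mult_right has_vector_derivative_diff
          D_f D_p)
    ultimately show ?thesis unfolding Veq by (rule vector_derivative_unique_at)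
  qed
  show ?thesis unfolding explicit_stages_def eq[symmetric] using Ueq by blast
qed

section \<open>The limit of the IMEX step\<close>

lemma leading_order_unique:
  assumes "leading_order G g" and "leading_order G h"
  shows "g = h"
proof
  fix x
  have "((\<lambda>\<epsilon>. (dx ^^ 0) (G \<epsilon>) x) \<longlongrightarrow> (dx ^^ 0) g x) (at_right 0)"
    "((\<lambda>\<epsilon>. (dx ^^ 0) (G \<epsilon>) x) \<longlongrightarrow> (dx ^^ 0) h x) (at_right 0)"
    using assms unfolding leading_order_def by blast+
  then show "g x = h x"
    using tendsto_unique[OF trivial_limit_at_right_real] by simp
qed

theorem theorem1:
  fixes At A :: "real^'s::{finite,wellorder}^'s::_" and bt b :: "real^'s::_"
    and f p un vn :: "real \<Rightarrow> real" and \<alpha> \<Delta>t :: real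
    and U V :: "real \<Rightarrow> real \<Rightarrow> real^'s::_" and u1 v1 :: "real \<Rightarrow> real \<Rightarrow> real"
  assumes "0 \<le> \<alpha>" and "\<alpha> \<le> 1" and "\<Delta>t > 0"
    and "smooth f" and "smooth p" and "\<And>w. deriv p w > 0"
    and "smooth un" and "smooth vn"
    and "imex_tableaux At A"
    and "type_I A \<or> type_II A"
    and "globally_stiffly_accurate At bt A b"
    and "\<forall>\<^sub>F \<epsilon> in at_right 0.
           imex_step At bt A b f p \<alpha> \<Delta>t \<epsilon> un vn (U \<epsilon>) (V \<epsilon>) (u1 \<epsilon>) (v1 \<epsilon>)"
  shows "(\<exists>U0 u0. leading_order U U0 \<and> leading_order u1 u0) \<and>
         (\<alpha> = 1 \<longrightarrow> (\<forall>U0 u0. leading_order U U0 \<and> leading_order u1 u0 \<longleftrightarrow>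
            rk_step_convection_diffusion At bt f p \<Delta>t un U0 u0)) \<and>
         (\<alpha> < 1 \<longrightarrow> (\<forall>U0 u0. leading_order U U0 \<and> leading_order u1 u0 \<longleftrightarrow>
            rk_step_conservation_law At bt f \<Delta>t un U0 u0))"
proof -
  define \<eta> where "\<eta> \<epsilon> = \<epsilon> powr (1 + \<alpha>) / \<Delta>t" for \<epsilon>
  define \<theta> where "\<theta> \<epsilon> = \<epsilon> powr (1 - \<alpha>)" for \<epsilon> :: real
  define \<theta>0 :: real where "\<theta>0 = (if \<alpha> = 1 then 1 else 0)"
  have strict: "At $ i $ j = 0" if "i \<le> j" for i j
    using \<open>imex_tableaux At A\<close> that unfolding imex_tableaux_def by blast
  have b: "A $ last_stage $ i = b $ i" for i
    using \<open>globally_stiffly_accurate At bt A b\<close> unfolding globally_stiffly_accurate_def by blast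
  \<comment> \<open>at the last index both sides are \<open>0\<close>: \<open>At\<close> has zero diagonal and the last explicit weight is \<open>0\<close>\<close>
  have bt: "At $ last_stage $ i = bt $ i" for i
    using \<open>globally_stiffly_accurate At bt A b\<close> strict[of last_stage last_stage]
    unfolding globally_stiffly_accurate_def by (cases "i = last_stage") auto

  have pos: "\<forall>\<^sub>F \<epsilon> in at_right (0::real). \<epsilon> > 0" by (rule eventually_at_right_less)
  have nonneg: "\<forall>\<^sub>F \<epsilon> in at_right (0::real). \<epsilon> \<ge> 0"
    using pos by (rule eventually_mono) simp
  have powr0: "((\<lambda>\<epsilon>. \<epsilon> powr a) \<longlongrightarrow> 0) (at_right (0::real))" if "a > 0" for a
    using tendsto_powr'[OF tendsto_ident_at tendsto_const, of 0 a "{0<..}"] that pos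
      nonneg by simp
  have \<eta>: "(\<eta> \<longlongrightarrow> 0) (at_right 0)"
    unfolding \<eta>_def using powr0[of "1 + \<alpha>"] \<open>0 \<le> \<alpha>\<close> by (intro tendsto_divide_zero) auto
  have \<eta>0: "\<forall>\<^sub>F \<epsilon> in at_right 0. \<eta> \<epsilon> \<noteq> 0"
    using pos by eventually_elim (use \<open>\<Delta>t > 0\<close> in \<open>auto simp: \<eta>_def\<close>)
  have \<theta>: "(\<theta> \<longlongrightarrow> \<theta>0) (at_right 0)"
  proof (cases "\<alpha> = 1")
    case True
    have "\<forall>\<^sub>F \<epsilon> in at_right 0. \<theta> \<epsilon> = 1"
      using pos by eventually_elim (simp add: \<theta>_def True)
    then show ?thesis
      using True tendsto_eventually by (auto simp: \<theta>0_def)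
  next
    case False
    then show ?thesis using powr0[of "1 - \<alpha>"] \<open>\<alpha> \<le> 1\<close> by (simp add: \<theta>_def[abs_def] \<theta>0_def)
  qed

  have stages: "\<forall>\<^sub>F \<epsilon> in at_right 0. imex_stages At A f p \<Delta>t (\<eta> \<epsilon>) (\<theta> \<epsilon>) un vn (U \<epsilon>) (V \<epsilon>)"
    using assms(12) pos
    by eventually_elim
      (unfold \<eta>_def \<theta>_def, rule imex_step_imp_imex_stages, use assms in auto)
  obtain U0 V0 where U0: "tendsto_smooth (at_right 0) U U0" and V0: "tendsto_smooth (at_right 0) V V0"
    using imex_stages_converge[OF \<open>imex_tableaux At A\<close>
        row_trivial_or_diagonal_nonzero[OF \<open>imex_tableaux At A\<close> \<open>type_I A \<or> type_II A\<close>]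
        assms(4,5,7,8) \<eta> \<eta>0 \<theta> stages] by blast
  have "imex_stages At A f p \<Delta>t 0 \<theta>0 un vn U0 V0"
    using imex_stages_limit[OF trivial_limit_at_right_real assms(4,5) \<eta> \<theta> stages U0 V0] .
  then have explicit: "explicit_stages At f p \<theta>0 \<Delta>t un U0"
    by (rule imex_stages_zero_imp_explicit_stages[OF assms(4,5)])

  \<comment> \<open>as \<open>b\<close> is the last row of \<open>A\<close>, the update of \<open>u\<close> repeats the last stage already before the limit\<close>
  define u0 where "u0 = (\<lambda>x. U0 x $ last_stage)"
  have "\<forall>\<^sub>F \<epsilon> in at_right 0. (\<lambda>x. U \<epsilon> x $ last_stage) = u1 \<epsilon>"
    using assms(12)
  proof eventually_elim
    case (elim \<epsilon>)
    then show ?case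
      unfolding imex_step_def by (simp add: fun_eq_iff matrix_vector_mult_def inner_vec_def b)
  qed
  moreover have "tendsto_smooth (at_right 0) (\<lambda>\<epsilon> x. U \<epsilon> x $ last_stage) u0"
    unfolding u0_def by (rule tendsto_smooth_vec_nth[OF U0])
  ultimately have u0: "tendsto_smooth (at_right 0) u1 u0"
    by (rule tendsto_smooth_cong)

  have lead: "leading_order U W \<and> leading_order u1 w \<longleftrightarrow> W = U0 \<and> w = u0" for W w
    using leading_order_unique tendsto_smooth_imp_leading_order[OF U0]
      tendsto_smooth_imp_leading_order[OF u0] by metis
  have "smooth U0" "smooth u0"
    using U0 u0 by (auto intro: tendsto_smooth_imp_smooth)
  then have rk: "W = U0 \<and> w = u0 \<longleftrightarrow> smooth W \<and> smooth w \<and>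
        (\<forall>x. (W x - un x *\<^sub>R vec 1) /\<^sub>R \<Delta>t + At *v dx (stagewise f W) x
            = \<theta>0 *\<^sub>R (At *v dx (dx (stagewise p W)) x)) \<and>
         (\<forall>x. (w x - un x) / \<Delta>t + bt \<bullet> dx (stagewise f W) x
            = \<theta>0 * (bt \<bullet> dx (dx (stagewise p W)) x))" for W w
    using explicit explicit_stages_unique[OF strict _ explicit, where W = W]
      rk_equations_iff_explicit_stages[OF \<open>\<Delta>t > 0\<close> assms(4,5) _ bt, of W un \<theta>0 w]
    unfolding u0_def by blast
  show ?thesis
  proof (intro conjI impI allI)
    show "\<exists>U0 u0. leading_order U U0 \<and> leading_order u1 u0" using lead by blast
    show "leading_order U W \<and> leading_order u1 w \<longleftrightarrow>
        rk_step_convection_diffusion At bt f p \<Delta>t un W w" if "\<alpha> = 1" for W w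
      using lead[of W w] rk[of W w] that unfolding rk_step_convection_diffusion_def \<theta>0_def by simp
    show "leading_order U W \<and> leading_order u1 w \<longleftrightarrow>
        rk_step_conservation_law At bt f \<Delta>t un W w" if "\<alpha> < 1" for W w
      using lead[of W w] rk[of W w] that unfolding rk_step_conservation_law_def \<theta>0_def by simp
  qed
qed

end
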